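(* Let $f,h_1,\dots,h_m:\mathbb{R}^n\to\mathbb{R}$ be continuously differentiable functions, and consider the problem of minimizing $f(x)$ over $x\in\mathbb{R}^n$ subject to $h_1(x)=0,\dots,h_m(x)=0$. Let $\overline{x}\in\mathbb{R}^n$ be a local solution of this problem, and suppose that the gradients $\nabla h_1(\overline{x}),\dots,\nabla h_m(\overline{x})$ are linearly independent. Then there exist $\lambda_1,\dots,\lambda_m\in\mathbb{R}$ such that $$\nabla f(\overline{x})+\sum_{i=1}^m\lambda_i\nabla h_i(\overline{x})=0.$$
   Context: Write $h:=(h_1,\dots,h_m)$. A point $\overline{x}\in\mathbb{R}^n$ is a local solution of the problem if $h(\overline{x})=0$ and $f(\overline{x})\leq f(x)$ for all $x$ sufficiently close to $\overline{x}$ such that $h(x)=0$. The symbol $\nabla$ denotes the gradient. The numbers $\lambda_1,\dots,\lambda_m$ are called Lagrange multipliers. *)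

theory Defs
  imports "HOL-Analysis.Analysis"
begin

definition gradient :: "('a::real_inner \<Rightarrow> real) \<Rightarrow> 'a \<Rightarrow> 'a" where
  "gradient f x = (THE D. GDERIV f x :> D)"

lemma gderiv_unique:
  fixes f :: "'a::real_inner \<Rightarrow> real"
  assumes "GDERIV f x :> D" "GDERIV f x :> E"
  shows "D = E"
proof -
  have "(\<lambda>h. h \<bullet> D) = (\<lambda>h. h \<bullet> E)"
    using assms has_derivative_unique unfolding gderiv_def by blast
  then have "(D - E) \<bullet> D = (D - E) \<bullet> E"
    by metis
  then have "(D - E) \<bullet> (D - E) = 0"
    by (simp add: inner_diff_right)
  then show ?thesis
    by simp
qed

lemma gradient_eq:
  fixes f :: "'a::real_inner \<Rightarrow> real"
  assumes "GDERIV f x :> D"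
  shows "gradient f x = D"
  unfolding gradient_def using assms gderiv_unique by (blast intro: the_equality)

lemma gderiv_gradient:
  fixes f :: "'a::euclidean_space \<Rightarrow> real"
  assumes "f differentiable (at x)"
  shows "GDERIV f x :> gradient f x"
proof -
  obtain f' where f': "(f has_derivative f') (at x)"
    using assms by (auto simp: differentiable_def)
  then have lin: "linear f'"
    by (rule has_derivative_linear)
  have "f' = (\<lambda>h. h \<bullet> adjoint f' 1)"
    using adjoint_works[OF lin, of _ "1::real"] by auto
  then have "GDERIV f x :> adjoint f' 1"
    using f' by (simp add: gderiv_def)
  then show ?thesis
    using gradient_eq by metis
qed

definition continuously_differentiable :: "('a::real_inner \<Rightarrow> real) \<Rightarrow> bool" where
  "continuously_differentiable f \<longleftrightarrow>
     (\<forall>x. f differentiable (at x)) \<and> continuous_on UNIV (gradient f)"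

text \<open>Linear independence of an indexed family. The library's \<open>independent\<close> applied to the image
  \<open>v ` I\<close> would overlook repeated vectors.\<close>

definition independent_family :: "('i \<Rightarrow> 'a::real_vector) \<Rightarrow> 'i set \<Rightarrow> bool" where
  "independent_family v I \<longleftrightarrow>
     (\<forall>c. (\<Sum>i\<in>I. c i *\<^sub>R v i) = 0 \<longrightarrow> (\<forall>i\<in>I. c i = 0))"

definition local_solution ::
  "('a::topological_space \<Rightarrow> real) \<Rightarrow> ('i \<Rightarrow> 'a \<Rightarrow> real) \<Rightarrow> 'i set \<Rightarrow> 'a \<Rightarrow> bool" where
  "local_solution f h I x \<longleftrightarrow>
     (\<forall>i\<in>I. h i x = 0) \<and>
     (\<forall>\<^sub>F y in nhds x. (\<forall>i\<in>I. h i y = 0) \<longrightarrow> f x \<le> f y)"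

lemma independent_family_iff:
  assumes "finite I"
  shows "independent_family v I \<longleftrightarrow> inj_on v I \<and> independent (v ` I)"
proof
  assume L: "independent_family v I"
  have inj: "inj_on v I"
  proof (rule inj_onI, rule ccontr)
    fix i j assume ij: "i \<in> I" "j \<in> I" "v i = v j" "i \<noteq> j"
    define c :: "'a \<Rightarrow> real" where "c = (\<lambda>k. if k = i then 1 else if k = j then -1 else 0)"
    have "(\<Sum>k\<in>I. c k *\<^sub>R v k) = (\<Sum>k\<in>{i,j}. c k *\<^sub>R v k)"
      using ij assms by (intro sum.mono_neutral_right) (auto simp: c_def)
    also have "\<dots> = 0"
      using ij by (simp add: c_def)
    finally have "c i = 0"
      using L ij unfolding independent_family_def by blast
    then show False
      by (simp add: c_def)
  qed
  have "\<forall>w\<in>v ` I. u w = 0" if "(\<Sum>w\<in>v ` I. u w *\<^sub>R w) = 0" for u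
    using L that unfolding independent_family_def sum.reindex[OF inj] o_def
    by (auto dest: spec[of _ "\<lambda>i. u (v i)"])
  then have "independent (v ` I)"
    using assms by (auto simp: dependent_finite)
  with inj show "inj_on v I \<and> independent (v ` I)" ..
next
  assume R: "inj_on v I \<and> independent (v ` I)"
  show "independent_family v I"
    unfolding independent_family_def
  proof (intro allI impI ballI)
    fix c i assume c: "(\<Sum>i\<in>I. c i *\<^sub>R v i) = 0" and i: "i \<in> I"
    have "(\<Sum>w\<in>v ` I. c (the_inv_into I v w) *\<^sub>R w) = (\<Sum>i\<in>I. c i *\<^sub>R v i)"
      using R by (subst sum.reindex) (auto simp: the_inv_into_f_f intro!: sum.cong)
    then have "c (the_inv_into I v (v i)) = 0"
      using R c i assms by (auto simp: dependent_finite)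
    then show "c i = 0"
      using R i by (simp add: the_inv_into_f_f)
  qed
qed

end

theory Submission
  imports Defs
begin

text \<open>If \<open>\<nabla>f(x)\<close> were not a linear combination of the \<open>\<nabla>h\<^sub>i(x)\<close>, then the whole family
  \<open>\<nabla>f(x), \<nabla>h\<^sub>1(x), \<dots>, \<nabla>h\<^sub>m(x)\<close> would be linearly independent. The derivative of
  \<open>(f, h\<^sub>1, \<dots>, h\<^sub>m)\<close> at \<open>x\<close> would then be onto, so the image of every neighbourhood of \<open>x\<close>
  would be a neighbourhood of \<open>(f x, 0, \<dots>, 0)\<close>. In particular some feasible point arbitrarily close
  to \<open>x\<close> would have an objective value below \<open>f x\<close>, and \<open>x\<close> would not be a local solution.

  This openness, along one direction of values, is \<open>independent_gradients_attain_nearby_values\<close>.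
  It rests on the open mapping theorem \<open>sussmann_open_mapping\<close>. That theorem speaks of a map between
  two fixed spaces, whereas here the number of values varies with the index set; the values are
  therefore encoded as the coefficients of the independent gradients inside the domain space itself.\<close>

text \<open>With \<open>B\<close> a basis of the orthogonal complement of the gradients \<open>v i\<close>, consider the self-map
  \<open>F y = (\<Sum>i. k i y v i) + (\<Sum>b\<in>B. (b \<bullet> y) b)\<close>. Its derivative \<open>F'\<close> at \<open>x\<close> satisfies
  \<open>d \<bullet> F' d = (\<Sum>i. (d \<bullet> v i)\<^sup>2) + (\<Sum>b\<in>B. (b \<bullet> d)\<^sup>2)\<close>. A \<open>d\<close> in the kernel is therefore orthogonal
  both to the gradients and to their complement, hence zero: \<open>F'\<close> is invertible and \<open>F\<close> is open at
  \<open>x\<close>. Conversely \<open>F\<close> loses no information on the values, because orthogonality separates the two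
  sums and independence recovers the coefficients of the first.\<close>

lemma independent_gradients_attain_nearby_values:
  fixes k :: "'i \<Rightarrow> 'a::euclidean_space \<Rightarrow> real"
  assumes I: "finite I"
    and cont: "\<And>i. i \<in> I \<Longrightarrow> continuous_on U (k i)"
    and grad: "\<And>i. i \<in> I \<Longrightarrow> GDERIV (k i) x :> v i"
    and indep: "independent_family v I"
    and U: "open U" "x \<in> U"
  shows "\<exists>t>0. \<exists>y\<in>U. \<forall>i\<in>I. k i y = k i x + t * c i"
proof -
  define W where "W = {w. \<forall>i\<in>I. orthogonal w (v i)}"
  have "subspace W"
    unfolding W_def by (auto simp: subspace_def orthogonal_def inner_add_left)
  then obtain B where B: "B \<subseteq> W" "independent B" "W \<subseteq> span B" "finite B"
    by (metis basis_exists independent_imp_finite)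
  have W_span: "span B \<subseteq> W"
    using B(1) \<open>subspace W\<close> by (rule span_minimal)
  define F where "F y = (\<Sum>i\<in>I. k i y *\<^sub>R v i) + (\<Sum>b\<in>B. (b \<bullet> y) *\<^sub>R b)" for y
  define F' where "F' d = (\<Sum>i\<in>I. (d \<bullet> v i) *\<^sub>R v i) + (\<Sum>b\<in>B. (b \<bullet> d) *\<^sub>R b)" for d
  have F': "(F has_derivative F') (at x)"
    unfolding F_def F'_def
    using grad by (auto simp: gderiv_def intro!: derivative_eq_intros)
  then have lin: "linear F'"
    by (rule has_derivative_linear)
  have "d = 0" if "F' d = 0" for d
  proof -
    have "0 = d \<bullet> F' d"
      using that by simp
    also have "\<dots> = (\<Sum>i\<in>I. (d \<bullet> v i)\<^sup>2) + (\<Sum>b\<in>B. (b \<bullet> d)\<^sup>2)"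
      by (simp add: F'_def inner_add_right inner_sum_right power2_eq_square inner_commute)
    finally have "(\<Sum>i\<in>I. (d \<bullet> v i)\<^sup>2) = 0" "(\<Sum>b\<in>B. (b \<bullet> d)\<^sup>2) = 0"
      using sum_nonneg[of I "\<lambda>i. (d \<bullet> v i)\<^sup>2"] sum_nonneg[of B "\<lambda>b. (b \<bullet> d)\<^sup>2"] by simp_all
    then have "\<forall>i\<in>I. d \<bullet> v i = 0" and dB: "\<forall>b\<in>B. b \<bullet> d = 0"
      using I B(4) by (simp_all add: sum_nonneg_eq_0_iff)
    then have "d \<in> span B"
      using B(3) by (auto simp: W_def orthogonal_def)
    then have "orthogonal d d"
      by (rule orthogonal_to_span) (use dB in \<open>auto simp: orthogonal_def inner_commute\<close>)
    then show "d = 0"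
      by (simp add: orthogonal_self)
  qed
  then have "inj F'"
    using lin by (simp add: linear_injective_0)
  then obtain G where G: "linear G" "\<forall>d. F' (G d) = d"
    using linear_injective_isomorphism[OF lin] by blast
  have contF: "continuous_on U F"
    unfolding F_def using cont by (intro continuous_intros) auto
  have "F x \<in> interior (F ` U)"
    using sussmann_open_mapping[OF U(1) contF U(2) F', of G U] G U
    by (auto simp: linear_conv_bounded_linear interior_open fun_eq_iff)
  then obtain e where e: "e > 0" "ball (F x) e \<subseteq> F ` U"
    by (auto simp: mem_interior)
  define g where "g = (\<Sum>i\<in>I. c i *\<^sub>R v i)"
  \<comment> \<open>Any \<open>t\<close> with \<open>t * norm g < e\<close> would do; the summand 1 covers \<open>g = 0\<close>.\<close>
  define t where "t = e / (norm g + 1)"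
  have t: "t > 0" "t * norm g < e"
    using e(1) by (auto simp: t_def field_simps add_pos_nonneg)
  then have "F x + t *\<^sub>R g \<in> ball (F x) e"
    by (simp add: dist_norm)
  then obtain y where y: "y \<in> U" "F y = F x + t *\<^sub>R g"
    using e(2) by (metis image_iff subsetD)
  define a where "a i = k i y - k i x - t * c i" for i
  define s where "s = (\<Sum>i\<in>I. a i *\<^sub>R v i)"
  define w where "w = (\<Sum>b\<in>B. (b \<bullet> (y - x)) *\<^sub>R b)"
  have "s + w = F y - F x - t *\<^sub>R g"
    by (simp add: s_def w_def a_def F_def g_def sum_subtractf scaleR_diff_left
        inner_diff_right scaleR_sum_right)
  then have sw: "s + w = 0"
    using y(2) by simp
  have "w \<in> span B"
    unfolding w_def by (intro span_sum span_scale span_base)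
  then have "w \<bullet> s = 0"
    using W_span by (auto simp: W_def s_def orthogonal_def inner_sum_right)
  moreover have "w = - s"
    using sw by (simp add: eq_neg_iff_add_eq_0 add.commute)
  ultimately have "s = 0"
    by simp
  then have "\<forall>i\<in>I. a i = 0"
    using indep unfolding independent_family_def s_def by blast
  then have "\<forall>i\<in>I. k i y = k i x + t * c i"
    unfolding a_def by (metis diff_diff_add eq_iff_diff_eq_0)
  with t(1) y(1) show ?thesis
    by blast
qed

theorem theorem1:
  fixes f :: "real ^ 'n \<Rightarrow> real"
    and h :: "nat \<Rightarrow> real ^ 'n \<Rightarrow> real"
    and m :: nat
    and x :: "real ^ 'n"
  assumes "continuously_differentiable f"
    and "\<And>i. i \<in> {1..m} \<Longrightarrow> continuously_differentiable (h i)"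
    and "local_solution f h {1..m} x"
    and "independent_family (\<lambda>i. gradient (h i) x) {1..m}"
  shows "\<exists>\<mu>::nat \<Rightarrow> real. gradient f x + (\<Sum>i=1..m. \<mu> i *\<^sub>R gradient (h i) x) = 0"
proof -
  \<comment> \<open>The constraints are numbered from 1, so the objective can take the index 0.\<close>
  define k where "k i = (if i = 0 then f else h i)" for i
  define v where "v i = gradient (k i) x" for i
  have split: "{0..m} = insert 0 {1..m}"
    by auto
  have kdiff: "k i differentiable (at y)" if "i \<in> {0..m}" for i y
    using assms(1,2) that by (auto simp: k_def continuously_differentiable_def)
  obtain U where U: "open U" "x \<in> U"
    and opt: "\<And>y. y \<in> U \<Longrightarrow> \<forall>i\<in>{1..m}. h i y = 0 \<Longrightarrow> f x \<le> f y"
    using assms(3) unfolding local_solution_def eventually_nhds by blast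
  have "\<not> independent_family v {0..m}"
  proof
    assume indep: "independent_family v {0..m}"
    have "\<exists>t>0. \<exists>y\<in>U. \<forall>i\<in>{0..m}. k i y = k i x + t * (if i = 0 then -1 else 0)"
    proof (rule independent_gradients_attain_nearby_values[OF _ _ _ indep U])
      fix i assume i: "i \<in> {0..m}"
      show "continuous_on U (k i)"
        using kdiff[OF i] by (meson continuous_at_imp_continuous_on differentiable_imp_continuous_within)
      show "GDERIV (k i) x :> v i"
        unfolding v_def using kdiff[OF i] by (rule gderiv_gradient)
    qed simp
    then obtain t y where t: "t > 0" and y: "y \<in> U"
      and val: "\<And>i. i \<in> {0..m} \<Longrightarrow> k i y = k i x + t * (if i = 0 then -1 else 0)"
      by blast
    have "h i y = 0" if "i \<in> {1..m}" for i
      using val[of i] that assms(3) by (auto simp: k_def local_solution_def)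
    then have "f x \<le> f y"
      using opt y by blast
    moreover have "f y = f x - t"
      using val[of 0] by (simp add: k_def)
    ultimately show False
      using t by simp
  qed
  then obtain c where c: "(\<Sum>i\<in>{0..m}. c i *\<^sub>R v i) = 0" and nz: "\<exists>i\<in>{0..m}. c i \<noteq> 0"
    unfolding independent_family_def by blast
  have sum_c: "c 0 *\<^sub>R gradient f x + (\<Sum>i=1..m. c i *\<^sub>R gradient (h i) x) = 0"
    using c unfolding split by (simp add: v_def k_def)
  have c0: "c 0 \<noteq> 0"
  proof
    assume "c 0 = 0"
    with sum_c have "\<forall>i\<in>{1..m}. c i = 0"
      using assms(4) unfolding independent_family_def by simp
    with \<open>c 0 = 0\<close> nz show False
      unfolding split by blast
  qed
  have "gradient f x + (\<Sum>i=1..m. (c i / c 0) *\<^sub>R gradient (h i) x)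
      = inverse (c 0) *\<^sub>R (c 0 *\<^sub>R gradient f x + (\<Sum>i=1..m. c i *\<^sub>R gradient (h i) x))"
    using c0 by (simp add: scaleR_add_right scaleR_sum_right divide_inverse_commute)
  then have "gradient f x + (\<Sum>i=1..m. (c i / c 0) *\<^sub>R gradient (h i) x) = 0"
    unfolding sum_c by simp
  then show ?thesis
    by (rule exI[where x = "\<lambda>i. c i / c 0"])
qed

end
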